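(* Let $q$ be a prime power and let $G\cong \mathrm{PSL}(3,q)$. Then $\Gamma_S(G)$ is not a cograph.
   Context: For a group $G$ with identity $e$, the intersection subgroup graph $\Gamma_S(G)$ is the simple graph whose vertices are the non-trivial subgroups $H$ of $G$ such that $H\cap K=\{e\}$ for some non-trivial subgroup $K$ of $G$; two distinct vertices $H,K$ are adjacent if and only if $H\cap K=\{e\}$. A graph is a cograph if it has no induced subgraph isomorphic to the path $P_4$ on four vertices. *)

theory Defs
  imports
    "HOL-Algebra.Coset"
    "HOL-Analysis.Determinants"
    "HOL-Number_Theory.Prime_Powers"
    "Graph_Theory.Pair_Digraph"
    "Graph_Theory.Digraph_Isomorphism"
begin

section \<open>Projective special linear groups\<close>

definition group_center :: "('a, 'm) monoid_scheme \<Rightarrow> 'a set" where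
  "group_center G =
    {z \<in> carrier G. \<forall>g \<in> carrier G. z \<otimes>\<^bsub>G\<^esub> g = g \<otimes>\<^bsub>G\<^esub> z}"

definition SL :: "('k::field ^ 'n ^ 'n) monoid" where
  "SL = \<lparr>carrier = {A. det A = 1}, monoid.mult = (**), one = mat 1\<rparr>"

definition PSL :: "('k::field ^ 'n ^ 'n) set monoid" where
  "PSL = SL Mod group_center SL"

lemma group_SL: "group (SL :: ('k::field ^ 'n ^ 'n) monoid)"
proof (rule groupI)
  fix A :: "'k ^ 'n ^ 'n"
  assume "A \<in> carrier SL"
  then have A: "det A = 1" by (simp add: SL_def)
  then have "invertible A" by (simp add: invertible_det_nz)
  then obtain B where B: "B ** A = mat 1" by (auto simp: invertible_def)
  have "det B * det A = 1" by (metis B det_I det_mul)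
  with A have "det B = 1" by simp
  with B show "\<exists>B \<in> carrier SL. B \<otimes>\<^bsub>SL\<^esub> A = \<one>\<^bsub>SL\<^esub>"
    by (auto simp: SL_def)
qed (simp_all add: SL_def det_mul matrix_mul_assoc)

lemma (in group) group_center_normal: "group_center G \<lhd> G"
proof -
  have sub: "subgroup (group_center G) G"
  proof (rule subgroupI)
    show "inv z \<in> group_center G" if "z \<in> group_center G" for z
    proof -
      have z: "z \<in> carrier G" and c: "\<And>g. g \<in> carrier G \<Longrightarrow> z \<otimes> g = g \<otimes> z"
        using that by (auto simp: group_center_def)
      have "inv z \<otimes> g = g \<otimes> inv z" if g: "g \<in> carrier G" for g
      proof -
        have "inv z \<otimes> g = inv (inv g \<otimes> z)" using z g by (simp add: inv_mult_group)
        also have "\<dots> = inv (z \<otimes> inv g)" using c g by simp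
        also have "\<dots> = g \<otimes> inv z" using z g by (simp add: inv_mult_group)
        finally show ?thesis .
      qed
      with z show ?thesis by (simp add: group_center_def)
    qed
    show "y \<otimes> z \<in> group_center G"
      if y: "y \<in> group_center G" and z: "z \<in> group_center G" for y z
    proof -
      have yz: "y \<in> carrier G" "z \<in> carrier G"
        using y z by (auto simp: group_center_def)
      have "(y \<otimes> z) \<otimes> g = g \<otimes> (y \<otimes> z)" if g: "g \<in> carrier G" for g
      proof -
        have c: "y \<otimes> g = g \<otimes> y" "z \<otimes> g = g \<otimes> z"
          using y z g by (auto simp: group_center_def)
        have "(y \<otimes> z) \<otimes> g = y \<otimes> (z \<otimes> g)" using yz g by (simp add: m_assoc)
        also have "\<dots> = y \<otimes> (g \<otimes> z)" by (simp only: c)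
        also have "\<dots> = (y \<otimes> g) \<otimes> z" using yz g by (simp add: m_assoc)
        also have "\<dots> = (g \<otimes> y) \<otimes> z" by (simp only: c)
        also have "\<dots> = g \<otimes> (y \<otimes> z)" using yz g by (simp add: m_assoc)
        finally show ?thesis .
      qed
      with yz show ?thesis by (simp add: group_center_def)
    qed
    show "group_center G \<subseteq> carrier G" by (auto simp: group_center_def)
    have "\<one> \<in> group_center G" by (simp add: group_center_def)
    then show "group_center G \<noteq> {}" by blast
  qed
  have "x \<otimes> z \<otimes> inv x \<in> group_center G"
    if x: "x \<in> carrier G" and z: "z \<in> group_center G" for x z
  proof -
    have zc: "z \<in> carrier G" and c: "x \<otimes> z = z \<otimes> x"
      using z x by (auto simp: group_center_def)
    have "x \<otimes> z \<otimes> inv x = z" using x zc by (simp add: c m_assoc)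
    with z show ?thesis by simp
  qed
  with sub show ?thesis by (simp add: normal_inv_iff)
qed

section \<open>Intersection subgroup graphs\<close>

text \<open>A simple graph is represented by its symmetric digraph: each edge is the pair of
  arcs \<open>(H, K)\<close>, \<open>(K, H)\<close>.\<close>

definition intersection_subgroup_graph ::
    "('a, 'm) monoid_scheme \<Rightarrow> 'a set pair_pre_digraph" where
  "intersection_subgroup_graph G =
    (let V = {H. subgroup H G \<and> H \<noteq> {\<one>\<^bsub>G\<^esub>} \<and>
                 (\<exists>K. subgroup K G \<and> K \<noteq> {\<one>\<^bsub>G\<^esub>} \<and> H \<inter> K = {\<one>\<^bsub>G\<^esub>})}
     in \<lparr>pverts = V,
         parcs = {(H, K). H \<in> V \<and> K \<in> V \<and> H \<noteq> K \<and> H \<inter> K = {\<one>\<^bsub>G\<^esub>}}\<rparr>)"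

lemma pair_bidirected_digraph_intersection_subgroup_graph:
  "pair_bidirected_digraph (intersection_subgroup_graph G)"
proof -
  have "arcs_ends (with_proj (intersection_subgroup_graph G)) =
      parcs (intersection_subgroup_graph G)"
    by (simp add: arcs_ends_conv with_proj_def)
  moreover have "sym (parcs (intersection_subgroup_graph G))"
    by (rule symI) (auto simp: intersection_subgroup_graph_def Let_def Int_commute)
  ultimately have sym: "symmetric (with_proj (intersection_subgroup_graph G))"
    by (simp add: symmetric_def)
  have ends: "fst e \<in> pverts (intersection_subgroup_graph G) \<and>
      snd e \<in> pverts (intersection_subgroup_graph G) \<and> fst e \<noteq> snd e"
    if "e \<in> parcs (intersection_subgroup_graph G)" for e
  proof (cases e)
    case (Pair H K)
    with that show ?thesis unfolding intersection_subgroup_graph_def Let_def by simp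
  qed
  show ?thesis
    by unfold_locales (use ends sym in blast)+
qed

section \<open>Cographs\<close>

definition path_graph :: "nat \<Rightarrow> nat pair_pre_digraph" where
  "path_graph n =
    \<lparr>pverts = {..<n}, parcs = {(i, j). i < n \<and> j < n \<and> (j = Suc i \<or> i = Suc j)}\<rparr>"

text \<open>Meant for loop-free symmetric digraphs without parallel arcs, that is, for simple graphs.\<close>

definition cograph :: "('a, 'b) pre_digraph \<Rightarrow> bool" where
  "cograph \<Gamma> \<longleftrightarrow>
    \<not> (\<exists>P. induced_subgraph P \<Gamma> \<and> digraph_iso P (with_proj (path_graph 4)))"

end

(* Among the root subgroups of upper unitriangular matrices, the chain X12, X12 X13, X13 X23, X23 has
   the property that exactly its consecutive members intersect non-trivially. So they induce the
   complement of a P4, which is again a P4, in the intersection subgroup graph of the unitriangular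
   group. The centre of SL(3, k) is scalar and thus meets that group trivially, so the chain survives
   in PSL(3, k). *)

theory Submission
  imports Defs
begin

text \<open>Reduces the search for an induced path to a labelling: \<open>v\<close> lists the four
  vertices in path order, and the arcs are read off from the labels.\<close>

lemma not_cographI:
  fixes v :: "nat \<Rightarrow> 'a"
  assumes wf: "wf_digraph (with_proj \<Gamma>)"
    and inj: "inj_on v {..<4}"
    and verts: "\<And>i. i < 4 \<Longrightarrow> v i \<in> pverts \<Gamma>"
    and arcs: "\<And>i j. i < 4 \<Longrightarrow> j < 4 \<Longrightarrow> (v i, v j) \<in> parcs \<Gamma> \<longleftrightarrow> j = Suc i \<or> i = Suc j"
  shows "\<not> cograph (with_proj \<Gamma>)"
proof -
  define V where "V = v ` {..<4}"
  define E where "E = parcs \<Gamma> \<inter> V \<times> V"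
  define P where "P = with_proj \<lparr>pverts = V, parcs = E\<rparr>"
  define w where "w = the_inv_into {..<4} v"
  \<comment> \<open>Arcs are pairs of vertices, so the inverse labelling \<open>w\<close> acts on
    them componentwise, and tail and head stay the two projections.\<close>
  define f where "f = \<lparr>iso_verts = w, iso_arcs = map_prod w w, iso_head = snd, iso_tail = fst\<rparr>"
  have wv: "w (v i) = i" if "i < 4" for i
    using that inj by (simp add: w_def the_inv_into_f_f)
  have E: "E = (\<lambda>(i, j). (v i, v j)) ` parcs (path_graph 4)"
    using arcs by (force simp: E_def V_def path_graph_def)
  have wfP: "wf_digraph P"
    by unfold_locales (auto simp: P_def E_def)
  have "induced_subgraph P (with_proj \<Gamma>)"
    using verts wf wfP
    by (auto simp: induced_subgraph_def subgraph_def compatible_def P_def E_def V_def)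
  moreover have "digraph_iso P (with_proj (path_graph 4))"
    unfolding digraph_iso_def
  proof (intro exI conjI)
    have "inj_on w V"
      by (auto simp: V_def inj_on_def wv)
    moreover from this have "inj_on (map_prod w w) E"
      unfolding E_def by (metis inf_le2 inj_on_subset map_prod_inj_on)
    ultimately show "pre_digraph.digraph_isomorphism P f"
      using wfP by (simp add: pre_digraph.digraph_isomorphism_def P_def f_def)
    have "w ` V = {..<4}"
      by (force simp: V_def wv)
    moreover have "map_prod w w ` E = parcs (path_graph 4)"
      unfolding E by (force simp: path_graph_def wv image_iff)
    ultimately show "with_proj (path_graph 4) = app_iso f P"
      by (simp add: app_iso_def P_def f_def with_proj_def path_graph_def)
  qed
  ultimately show ?thesis
    unfolding cograph_def by blast
qed

text \<open>Adjacency means trivial intersection, so the chain \<open>A\<close>, \<open>B\<close>,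
  \<open>C\<close>, \<open>D\<close> of non-trivial intersections is a path of non-edges. The edges
  are \<open>C A\<close>, \<open>A D\<close>, \<open>D B\<close>, again a path.\<close>

lemma not_cograph_intersection_subgroup_graphI:
  assumes "subgroup A G" "subgroup B G" "subgroup C G" "subgroup D G"
    and nontriv: "A \<inter> B \<noteq> {\<one>\<^bsub>G\<^esub>}" "B \<inter> C \<noteq> {\<one>\<^bsub>G\<^esub>}" "C \<inter> D \<noteq> {\<one>\<^bsub>G\<^esub>}"
    and triv: "A \<inter> C = {\<one>\<^bsub>G\<^esub>}" "A \<inter> D = {\<one>\<^bsub>G\<^esub>}" "B \<inter> D = {\<one>\<^bsub>G\<^esub>}"
  shows "\<not> cograph (with_proj (intersection_subgroup_graph G))"
proof (rule not_cographI)
  \<comment> \<open>The path order given by the three trivial intersections.\<close>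
  define v where "v = (!) [C, A, D, B]"
  let ?\<Gamma> = "intersection_subgroup_graph G"
  have v: "v 0 = C" "v (Suc 0) = A" "v (Suc (Suc 0)) = D" "v (Suc (Suc (Suc 0))) = B"
    by (simp_all add: v_def)
  have less_4: "i < 4 \<longleftrightarrow> i = 0 \<or> i = Suc 0 \<or> i = Suc (Suc 0) \<or> i = Suc (Suc (Suc 0))" for i :: nat
    by auto
  have one: "\<one>\<^bsub>G\<^esub> \<in> A" "\<one>\<^bsub>G\<^esub> \<in> B" "\<one>\<^bsub>G\<^esub> \<in> C" "\<one>\<^bsub>G\<^esub> \<in> D"
    using assms(1-4) by (simp_all add: subgroup.one_closed)
  have ne1: "A \<noteq> {\<one>\<^bsub>G\<^esub>}" "B \<noteq> {\<one>\<^bsub>G\<^esub>}" "C \<noteq> {\<one>\<^bsub>G\<^esub>}" "D \<noteq> {\<one>\<^bsub>G\<^esub>}"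
    using nontriv one by auto
  \<comment> \<open>Equality in a pair that meets trivially would make both members trivial.
    Consecutive members are told apart by a third: \<open>C\<close> meets \<open>B\<close> but not
    \<open>A\<close>, \<open>A\<close> meets \<open>B\<close> but not \<open>C\<close>,
    \<open>B\<close> meets \<open>C\<close> but not \<open>D\<close>, up to the identity.\<close>
  have ne: "A \<noteq> B" "A \<noteq> C" "A \<noteq> D" "B \<noteq> C" "B \<noteq> D" "C \<noteq> D"
    using triv nontriv ne1 by (auto simp: Int_commute)
  have nontriv': "B \<inter> A \<noteq> {\<one>\<^bsub>G\<^esub>}" "C \<inter> B \<noteq> {\<one>\<^bsub>G\<^esub>}" "D \<inter> C \<noteq> {\<one>\<^bsub>G\<^esub>}"
    using nontriv by (simp_all add: Int_commute)
  have V: "A \<in> pverts ?\<Gamma>" "B \<in> pverts ?\<Gamma>" "C \<in> pverts ?\<Gamma>" "D \<in> pverts ?\<Gamma>"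
    using assms(1-4) triv ne1 by (auto simp: intersection_subgroup_graph_def Let_def Int_commute)
  have arcs: "(H, K) \<in> parcs ?\<Gamma> \<longleftrightarrow> H \<noteq> K \<and> H \<inter> K = {\<one>\<^bsub>G\<^esub>}"
    if "H \<in> pverts ?\<Gamma>" "K \<in> pverts ?\<Gamma>" for H K
    using that by (auto simp: intersection_subgroup_graph_def Let_def)
  interpret pair_bidirected_digraph ?\<Gamma>
    by (rule pair_bidirected_digraph_intersection_subgroup_graph)
  show "wf_digraph (with_proj ?\<Gamma>)" ..
  show "inj_on v {..<4}"
    using ne by (auto simp: inj_on_def less_4 v)
  show "v i \<in> pverts ?\<Gamma>" if "i < 4" for i
    using that V by (auto simp: less_4 v)
  show "(v i, v j) \<in> parcs ?\<Gamma> \<longleftrightarrow> j = Suc i \<or> i = Suc j" if "i < 4" "j < 4" for i j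
    using that unfolding less_4
    by (elim disjE)
      (simp_all add: v V arcs ne ne[symmetric] nontriv nontriv' triv triv[THEN trans[OF Int_commute]])
qed

text \<open>The Heisenberg group over \<open>'k\<close>: \<open>a\<close>, \<open>b\<close>,
  \<open>c\<close> are the entries of the root subgroups X12, X13, X23.\<close>

definition unitri :: "'k::field \<Rightarrow> 'k \<Rightarrow> 'k \<Rightarrow> 'k ^ 3 ^ 3" where
  "unitri a b c = vector [vector [1, a, b], vector [0, 1, c], vector [0, 0, 1]]"

lemma unitri_nth [simp]:
  "unitri a b c $ 1 $ 1 = 1" "unitri a b c $ 1 $ 2 = a" "unitri a b c $ 1 $ 3 = b"
  "unitri a b c $ 2 $ 1 = 0" "unitri a b c $ 2 $ 2 = 1" "unitri a b c $ 2 $ 3 = c"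
  "unitri a b c $ 3 $ 1 = 0" "unitri a b c $ 3 $ 2 = 0" "unitri a b c $ 3 $ 3 = 1"
  by (simp_all add: unitri_def)

lemma unitri_eq_iff [simp]: "unitri a b c = unitri a' b' c' \<longleftrightarrow> a = a' \<and> b = b' \<and> c = c'"
  by (auto simp: vec_eq_iff forall_3)

lemma unitri_mult:
  "unitri a b c ** unitri a' b' c' = unitri (a + a') (b + b' + a * c') (c + c')"
  by (simp add: vec_eq_iff forall_3 matrix_matrix_mult_def sum_3 algebra_simps)

lemma unitri_0: "unitri 0 0 0 = mat 1"
  by (simp add: vec_eq_iff forall_3 mat_def)

lemma det_unitri: "det (unitri a b c) = 1"
  by (simp add: det_3)

text \<open>Turns the subgroup property into conditions on coordinates. The cross term
  \<open>a * c'\<close> comes from the matrix product, and \<open>a * c - b\<close> is the corner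
  entry of the inverse.\<close>

lemma subgroup_unitri:
  fixes S :: "('k::field \<times> 'k \<times> 'k) set"
  assumes zero: "(0, 0, 0) \<in> S"
    and add: "\<And>a b c a' b' c'. (a, b, c) \<in> S \<Longrightarrow> (a', b', c') \<in> S \<Longrightarrow>
      (a + a', b + b' + a * c', c + c') \<in> S"
    and uminus: "\<And>a b c. (a, b, c) \<in> S \<Longrightarrow> (- a, a * c - b, - c) \<in> S"
  shows "subgroup ((\<lambda>(a, b, c). unitri a b c) ` S) SL"
    (is "subgroup (?u ` S) SL")
proof -
  interpret SL: group "SL :: ('k ^ 3 ^ 3) monoid"
    by (rule group_SL)
  show ?thesis
  proof (rule SL.subgroupI)
    show "?u ` S \<subseteq> carrier SL"
      by (auto simp: SL_def det_unitri)
    show "?u ` S \<noteq> {}"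
      using zero by blast
    show "x \<otimes>\<^bsub>SL\<^esub> y \<in> ?u ` S" if "x \<in> ?u ` S" "y \<in> ?u ` S" for x y
      using that add by (force simp: SL_def unitri_mult)
    show "inv\<^bsub>SL\<^esub> x \<in> ?u ` S" if x: "x \<in> ?u ` S" for x
    proof -
      obtain a b c where S: "(a, b, c) \<in> S" and x: "x = unitri a b c"
        using x by auto
      have "inv\<^bsub>SL\<^esub> x = unitri (- a) (a * c - b) (- c)"
        by (rule SL.inv_equality) (simp_all add: x SL_def det_unitri unitri_mult unitri_0)
      with uminus[OF S] show ?thesis
        by force
    qed
  qed
qed

text \<open>Commuting with I + Eij is commuting with the matrix unit Eij. E21 and E32 make the
  diagonal of \<open>z\<close> constant and kill every other entry except the one at (3,1), which
  E13 kills.\<close>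

lemma group_center_SL_3:
  assumes "z \<in> group_center (SL :: ('k::field ^ 3 ^ 3) monoid)"
  shows "\<exists>s. z = mat s"
proof -
  \<comment> \<open>\<open>x\<close>, \<open>y\<close> and \<open>unitri 0 1 0\<close> are the
    transvections I + E21, I + E32 and I + E13.\<close>
  define x :: "'k ^ 3 ^ 3" where "x = vector [vector [1, 0, 0], vector [1, 1, 0], vector [0, 0, 1]]"
  define y :: "'k ^ 3 ^ 3" where "y = vector [vector [1, 0, 0], vector [0, 1, 0], vector [0, 1, 1]]"
  have "g \<in> carrier SL \<Longrightarrow> z ** g = g ** z" for g
    using assms by (simp add: group_center_def SL_def)
  moreover have "x \<in> carrier SL" "y \<in> carrier SL" "unitri 0 1 0 \<in> carrier SL"
    by (simp_all add: SL_def det_3 x_def y_def)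
  ultimately have "z ** x = x ** z" "z ** y = y ** z" "z ** unitri 0 1 0 = unitri 0 1 0 ** z"
    by blast+
  then have "z = mat (z $ 1 $ 1)"
    by (simp add: vec_eq_iff forall_3 matrix_matrix_mult_def sum_3 mat_def x_def y_def)
  then show ?thesis ..
qed

text \<open>Two unitriangular matrices in one coset of the centre differ by a scalar factor, and
  their diagonals of ones force it to be 1.\<close>

lemma inj_on_unitri_center_coset:
  "inj_on (\<lambda>x. group_center SL #>\<^bsub>SL\<^esub> x) {unitri a b c | a b c :: 'k::field. True}"
proof (rule inj_onI, clarify)
  fix a b c a' b' c' :: 'k
  let ?SL = "SL :: ('k ^ 3 ^ 3) monoid"
  interpret SL: group ?SL
    by (rule group_SL)
  assume eq: "group_center SL #>\<^bsub>SL\<^esub> unitri a b c = group_center SL #>\<^bsub>SL\<^esub> unitri a' b' c'"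
  have "subgroup (group_center ?SL) ?SL"
    by (rule normal_imp_subgroup[OF SL.group_center_normal])
  then have "unitri a b c \<in> group_center SL #>\<^bsub>SL\<^esub> unitri a b c"
    by (rule SL.rcos_self[rotated]) (simp add: SL_def det_unitri)
  then obtain z where "z \<in> group_center SL" "unitri a b c = z ** unitri a' b' c'"
    unfolding eq by (auto simp: r_coset_def SL_def)
  then obtain s where "unitri a b c = mat s ** unitri a' b' c'"
    using group_center_SL_3 by blast
  then show "unitri a b c = unitri a' b' c'"
    by (simp add: vec_eq_iff forall_3 matrix_matrix_mult_def sum_3 mat_def)
qed

theorem theorem8p6:
  fixes G :: "('a, 'm) monoid_scheme" and q :: nat
  assumes "primepow q"
    and "CARD('k::{field,finite}) = q"
    and "group G"
    and "G \<cong> (PSL :: ('k ^ 3 ^ 3) set monoid)"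
  shows "\<not> cograph (with_proj (intersection_subgroup_graph G))"
proof -
  let ?SL = "SL :: ('k ^ 3 ^ 3) monoid"
  let ?PSL = "PSL :: ('k ^ 3 ^ 3) set monoid"
  define U :: "('k ^ 3 ^ 3) set" where "U = {unitri a b c | a b c. True}"
  define \<pi> where "\<pi> = (\<lambda>x. group_center ?SL #>\<^bsub>?SL\<^esub> x)"
  interpret SL: group ?SL
    by (rule group_SL)
  have \<pi>: "\<pi> \<in> hom ?SL ?PSL"
    unfolding \<pi>_def PSL_def by (rule normal.r_coset_hom_Mod[OF SL.group_center_normal])
  obtain h where h: "h \<in> iso ?PSL G"
    using group.iso_sym[OF assms(3,4)] by (auto simp: is_iso_def)
  \<comment> \<open>The chain is built from matrices and carried to \<open>G\<close> by
    \<open>f\<close>. Injectivity of \<open>f\<close> on \<open>U\<close> is enough, since all four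
    subgroups lie in \<open>U\<close>.\<close>
  define f where "f = h \<circ> \<pi>"
  interpret group_hom ?SL G f
    using hom_compose[OF \<pi>] h assms(3)
    by (auto simp: f_def iso_def intro!: group_hom.intro SL.is_group group_hom_axioms.intro)
  have U: "U \<subseteq> carrier ?SL"
    by (auto simp: U_def SL_def det_unitri)
  have "inj_on h (carrier ?PSL)"
    using h by (simp add: iso_def bij_betw_def)
  moreover have "\<pi> ` U \<subseteq> carrier ?PSL"
    using U hom_carrier[OF \<pi>] by blast
  ultimately have f: "inj_on f U"
    unfolding f_def U_def \<pi>_def
    by (intro comp_inj_on inj_on_unitri_center_coset) (rule inj_on_subset)
  \<comment> \<open>X12, X12 X13, X13 X23 and X23, in this order.\<close>
  define A where "A = (\<lambda>(a, b, c). unitri a b c) ` {(a, b, c) | a b c :: 'k. b = 0 \<and> c = 0}"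
  define B where "B = (\<lambda>(a, b, c). unitri a b c) ` {(a, b, c) | a b c :: 'k. c = 0}"
  define C where "C = (\<lambda>(a, b, c). unitri a b c) ` {(a, b, c) | a b c :: 'k. a = 0}"
  define D where "D = (\<lambda>(a, b, c). unitri a b c) ` {(a, b, c) | a b c :: 'k. a = 0 \<and> b = 0}"
  note defs = A_def B_def C_def D_def
  \<comment> \<open>On each set \<open>a\<close> is constantly 0 or \<open>c\<close> is constantly
    0, so the cross terms vanish.\<close>
  have sub: "subgroup A ?SL" "subgroup B ?SL" "subgroup C ?SL" "subgroup D ?SL"
    unfolding defs by (rule subgroup_unitri; simp)+
  have subU: "A \<subseteq> U" "B \<subseteq> U" "C \<subseteq> U" "D \<subseteq> U"
    by (auto simp: defs U_def)
  \<comment> \<open>This and \<open>f_eq_1\<close> transfer trivial and non-trivial intersections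
    from \<open>U\<close> to \<open>G\<close>.\<close>
  have f_Int: "f ` H \<inter> f ` K = f ` (H \<inter> K)" if "H \<subseteq> U" "K \<subseteq> U" for H K
    using inj_on_image_Int[OF f that] by simp
  have f_1: "f (mat 1) = \<one>\<^bsub>G\<^esub>"
    using hom_one by (simp add: SL_def)
  have f_eq_1: "f ` H = {\<one>\<^bsub>G\<^esub>} \<longleftrightarrow> H = {mat 1}" if "H \<subseteq> U" for H
  proof -
    have "mat 1 \<in> U"
      unfolding U_def unitri_0[symmetric] by blast
    then show ?thesis
      using inj_on_image_eq_iff[OF f that, of "{mat 1}"] f_1 by simp
  qed
  \<comment> \<open>Witnesses from the root subgroup shared by each consecutive pair.\<close>
  have "unitri 1 0 0 \<in> A \<inter> B" "unitri 0 1 0 \<in> B \<inter> C" "unitri 0 0 1 \<in> C \<inter> D"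
    by (force simp: defs)+
  then have nontriv: "A \<inter> B \<noteq> {mat 1}" "B \<inter> C \<noteq> {mat 1}" "C \<inter> D \<noteq> {mat 1}"
    unfolding unitri_0[symmetric] by (metis singletonD unitri_eq_iff zero_neq_one)+
  \<comment> \<open>Non-consecutive members have no free coordinate in common.\<close>
  have triv: "A \<inter> C = {mat 1}" "A \<inter> D = {mat 1}" "B \<inter> D = {mat 1}"
    unfolding unitri_0[symmetric] by (force simp: defs)+
  show ?thesis
    by (rule not_cograph_intersection_subgroup_graphI[of "f ` A" _ "f ` B" "f ` C" "f ` D"])
      (use sub subU nontriv triv in
        \<open>simp_all add: subgroup_img_is_subgroup f_Int f_eq_1 f_1 le_infI1\<close>)
qed

end
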